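(* Let $k\ge s\ge r\ge2$ be integers and let $G$ be an $s$-uniform hypergraph with $k$ vertices and $m$ edges. Let $\omega=\omega(n)\to\infty$ as $n\to\infty$ and $t=n^{r-(k-s+r)/m}/\omega$. Then for any strategy $\mathcal S$, $$\lim_{n\to\infty}\mathbb P\big[H_t^{(r,s)}\text{ contains a sub-hypergraph isomorphic to } G\big]=0.$$ As a result, $\tau^{(r)}_{\mathcal P_G}\ge r-(k-s+r)/m$.
   Context: Semi-random hypergraph process with parameters $1\le r\le s$ on $[n]$: start with the empty hypergraph $H_0^{(r,s)}$ on $[n]$; in each step $t\ge1$ an $r$-set $U_t$ is chosen uniformly at random from $\binom{[n]}{r}$, the player (knowing the history and $U_t$; possibly randomizing; a rule for doing so for all $n,t$ is a strategy $\mathcal S$) selects $s-r$ vertices $V_t$ (repetitions/overlap allowed) and the multiset edge $U_t\cup V_t$ is added to form $H_t^{(r,s)}$ (parallel edges allowed). $\mathcal P_G$ is the property of containing a sub-hypergraph isomorphic to $G$. For a monotonically increasing property $\mathcal P$, a strategy $\mathcal S$ and $0<q<1$, let $\tau^{(r)}_{\mathcal P}(\mathcal S,q,n)$ be the minimum $t\ge0$ with $\mathbb P[H^{(r,s)}_t\in\mathcal P]\ge q$ (or $\infty$), $\tau^{(r)}_{\mathcal P}(q,n)=\inf_{\mathcal S}\tau^{(r)}_{\mathcal P}(\mathcal S,q,n)$, and $\tau^{(r)}_{\mathcal P}=\lim_{q\to1^-}\limsup_{n\to\infty}\frac{\ln\tau^{(r)}_{\mathcal P}(q,n)}{\ln n}$.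 *)

theory Defs
  imports "HOL-Probability.Probability"
begin

(* Edges are multisets of vertices and the edges themselves form a multiset, as the
   semi-random process creates both repeated vertices in an edge and parallel edges. *)
datatype 'a hypergraph = Hypergraph (verts: "'a set") (edges: "'a multiset multiset")

definition wf_hypergraph :: "'a hypergraph \<Rightarrow> bool" where
  "wf_hypergraph H \<longleftrightarrow> finite (verts H) \<and> (\<forall>e \<in># edges H. set_mset e \<subseteq> verts H)"

(* An s-uniform hypergraph in the usual sense: a set (no parallel edges) of s-element
   sets (no repeated vertices) of vertices. *)
definition uniform_hypergraph :: "nat \<Rightarrow> 'a hypergraph \<Rightarrow> bool" where
  "uniform_hypergraph s G \<longleftrightarrow> wf_hypergraph G \<and>
     (\<forall>e. count (edges G) e \<le> 1) \<and>
     (\<forall>e \<in># edges G. size e = s \<and> (\<forall>v. count e v \<le> 1))"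

definition sub_hypergraph :: "'a hypergraph \<Rightarrow> 'a hypergraph \<Rightarrow> bool" where
  "sub_hypergraph H' H \<longleftrightarrow>
     wf_hypergraph H' \<and> verts H' \<subseteq> verts H \<and> edges H' \<subseteq># edges H"

definition hypergraph_iso :: "'a hypergraph \<Rightarrow> 'b hypergraph \<Rightarrow> bool" where
  "hypergraph_iso G H \<longleftrightarrow>
     (\<exists>f. bij_betw f (verts G) (verts H) \<and> edges H = image_mset (image_mset f) (edges G))"

definition contains_copy :: "'a hypergraph \<Rightarrow> 'b hypergraph \<Rightarrow> bool" where
  "contains_copy G H \<longleftrightarrow> (\<exists>H'. sub_hypergraph H' H \<and> hypergraph_iso G H')"

(* The history [(U_1,V_1), ..., (U_t,V_t)] of the first t steps. *)
type_synonym history = "(nat set \<times> nat multiset) list"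

(* S n h U is the distribution of the player's choice V on the vertex set {1..n}, given the
   history h and the newly drawn set U; the number of the step is length h + 1. *)
type_synonym strategy = "nat \<Rightarrow> history \<Rightarrow> nat set \<Rightarrow> nat multiset pmf"

definition r_sets :: "nat \<Rightarrow> nat \<Rightarrow> nat set set" where
  "r_sets r n = {U. U \<subseteq> {1..n} \<and> card U = r}"

definition valid_strategy :: "nat \<Rightarrow> nat \<Rightarrow> strategy \<Rightarrow> bool" where
  "valid_strategy r s S \<longleftrightarrow>
     (\<forall>n h. \<forall>U \<in> r_sets r n. \<forall>V \<in> set_pmf (S n h U). set_mset V \<subseteq> {1..n} \<and> size V = s - r)"

(* For n < r there is no r-set to draw and the distribution is unspecified; only the
   behaviour as n tends to infinity is ever used. *)
primrec history_pmf :: "nat \<Rightarrow> strategy \<Rightarrow> nat \<Rightarrow> nat \<Rightarrow> history pmf" where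
  "history_pmf r S n 0 = return_pmf []"
| "history_pmf r S n (Suc t) = do {
     h \<leftarrow> history_pmf r S n t;
     U \<leftarrow> pmf_of_set (r_sets r n);
     V \<leftarrow> S n h U;
     return_pmf (h @ [(U, V)])
   }"

definition history_hypergraph :: "nat \<Rightarrow> history \<Rightarrow> nat hypergraph" where
  "history_hypergraph n h = Hypergraph {1..n} (mset (map (\<lambda>(U, V). mset_set U + V) h))"

definition semirandom_hypergraph :: "nat \<Rightarrow> strategy \<Rightarrow> nat \<Rightarrow> nat \<Rightarrow> nat hypergraph pmf" where
  "semirandom_hypergraph r S n t = map_pmf (history_hypergraph n) (history_pmf r S n t)"

definition prob_property ::
  "nat \<Rightarrow> strategy \<Rightarrow> nat \<Rightarrow> nat \<Rightarrow> (nat hypergraph \<Rightarrow> bool) \<Rightarrow> real" where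
  "prob_property r S n t P = measure_pmf.prob (semirandom_hypergraph r S n t) {H. P H}"

(* The infimum of the empty set is infinity in enat. *)
definition tau_strategy ::
  "nat \<Rightarrow> (nat hypergraph \<Rightarrow> bool) \<Rightarrow> strategy \<Rightarrow> real \<Rightarrow> nat \<Rightarrow> enat" where
  "tau_strategy r P S q n = (INF t \<in> {t. prob_property r S n t P \<ge> q}. enat t)"

definition tau_q :: "nat \<Rightarrow> nat \<Rightarrow> (nat hypergraph \<Rightarrow> bool) \<Rightarrow> real \<Rightarrow> nat \<Rightarrow> enat" where
  "tau_q r s P q n = (INF S \<in> {S. valid_strategy r s S}. tau_strategy r P S q n)"

(* The logarithm with ln 0 = -infinity and ln infinity = infinity. *)
definition ln_enat :: "enat \<Rightarrow> ereal" where
  "ln_enat x = (case x of enat t \<Rightarrow> if t = 0 then -\<infinity> else ereal (ln (real t)) | \<infinity> \<Rightarrow> \<infinity>)"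

definition tau_limsup :: "nat \<Rightarrow> nat \<Rightarrow> (nat hypergraph \<Rightarrow> bool) \<Rightarrow> real \<Rightarrow> ereal" where
  "tau_limsup r s P q = limsup (\<lambda>n. ln_enat (tau_q r s P q n) / ereal (ln (real n)))"

definition tau :: "nat \<Rightarrow> nat \<Rightarrow> (nat hypergraph \<Rightarrow> bool) \<Rightarrow> ereal" where
  "tau r s P = Lim (at_left 1) (tau_limsup r s P)"

lemma ln_enat_mono: "x \<le> y \<Longrightarrow> ln_enat x \<le> ln_enat y"
  by (cases x; cases y) (auto simp: ln_enat_def)

lemma tau_limsup_mono:
  assumes "q \<le> q'"
  shows "tau_limsup r s P q \<le> tau_limsup r s P q'"
proof -
  have S: "tau_strategy r P S q n \<le> tau_strategy r P S q' n" for S n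
    unfolding tau_strategy_def using assms by (intro INF_superset_mono) auto
  have "tau_q r s P q n \<le> tau_q r s P q' n" for n
    unfolding tau_q_def by (intro INF_mono) (use S in blast)
  then have ln: "ln_enat (tau_q r s P q n) \<le> ln_enat (tau_q r s P q' n)" for n
    by (rule ln_enat_mono)
  have "\<forall>\<^sub>F n in sequentially. ln_enat (tau_q r s P q n) / ereal (ln (real n))
          \<le> ln_enat (tau_q r s P q' n) / ereal (ln (real n))"
    using eventually_gt_at_top[of 1]
  proof eventually_elim
    case (elim n)
    then show ?case by (intro ereal_divide_right_mono ln) auto
  qed
  then show ?thesis
    unfolding tau_limsup_def by (rule Limsup_mono)
qed

(* The limit in the definition of tau always exists. *)
lemma tendsto_tau: "(tau_limsup r s P \<longlongrightarrow> tau r s P) (at_left 1)"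
proof -
  let ?L = "SUP q \<in> {..<1}. tau_limsup r s P q"
  have "(tau_limsup r s P \<longlongrightarrow> ?L) (at_left 1)"
  proof (rule increasing_tendsto)
    show "\<forall>\<^sub>F q in at_left 1. tau_limsup r s P q \<le> ?L"
      by (auto simp: eventually_at_filter intro!: always_eventually SUP_upper)
  next
    fix x assume "x < ?L"
    then obtain q where q: "q < 1" "x < tau_limsup r s P q"
      by (auto simp: less_SUP_iff)
    show "\<forall>\<^sub>F q in at_left 1. x < tau_limsup r s P q"
      using eventually_at_left_real[OF q(1)]
    proof eventually_elim
      case (elim q')
      then show ?case
        using q(2) tau_limsup_mono[of q q' r s P] by (auto intro: less_le_trans)
    qed
  qed
  then show ?thesis
    unfolding tau_def by (simp add: tendsto_Lim)
qed

end

theory Submission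
  imports Defs
begin

text \<open>First moment method. For a set \<open>A\<close> of \<open>j\<close> edges of \<open>G\<close> let \<open>E\<^sub>t(A)\<close> be the expected
  number of maps from the vertices of \<open>G\<close> to \<open>[n]\<close> under which all edges of \<open>A\<close> are present after
  \<open>t\<close> steps. A single edge is hit by at most \<open>t s\<^sup>s n\<^bsup>k-s\<^esup>\<close> maps, however the player acts, while any
  prescribed edge arises in a given step with probability at most \<open>p = O(n\<^bsup>-r\<^esup>)\<close>, since \<open>U\<^sub>t\<close> must lie
  in it. Splitting according to the edge created in the last step gives
  \<open>E\<^bsub>t+1\<^esub>(A) \<le> E\<^sub>t(A) + p \<Sum>\<^bsub>e\<in>A\<^esub> E\<^sub>t(A - e)\<close> and hence \<open>E\<^sub>t(A) \<le> t\<^bsup>j\<^esup> p\<^bsup>j-1\<^esup> s\<^sup>s n\<^bsup>k-s\<^esup>\<close>.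
  For the full edge set this is a constant times \<open>(t / n\<^bsup>a\<^esup>)\<^bsup>m\<^esup>\<close> with \<open>a = r - (k-s+r)/m\<close>,
  uniformly over all strategies.\<close>

section \<open>Histories and the law of a single step\<close>

definition hist_edges :: "history \<Rightarrow> nat multiset multiset" where
  "hist_edges h = mset (map (\<lambda>(U, V). mset_set U + V) h)"

text \<open>Separating the law of one step given the history turns the recursion for
  \<open>history_pmf\<close> into a single bind, so probabilities can be computed by conditioning on
  \<open>h\<close>.\<close>

definition step_pmf :: "nat \<Rightarrow> strategy \<Rightarrow> nat \<Rightarrow> history \<Rightarrow> (nat set \<times> nat multiset) pmf" where
  "step_pmf r S n h = pmf_of_set (r_sets r n) \<bind> (\<lambda>U. map_pmf (Pair U) (S n h U))"

lemma card_set_mset_le_size: "card (set_mset M) \<le> size M"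
  by (induction M) (auto simp: card_insert_if)

text \<open>Serves both levels of simplicity in \<open>G\<close>: an edge without repeated vertices
  and an edge multiset without parallel edges.\<close>

lemma mset_set_set_mset_distinct:
  assumes "\<And>x. count M x \<le> 1"
  shows "mset_set (set_mset M) = M"
  using assms by (intro multiset_eqI) (metis count_eq_zero_iff count_mset_set(1,3)
      finite_set_mset le_antisym One_nat_def Suc_leI gr0I)

lemma history_pmf_Suc:
  "history_pmf r S n (Suc t) =
     history_pmf r S n t \<bind> (\<lambda>h. map_pmf (\<lambda>x. h @ [x]) (step_pmf r S n h))"
  by (simp add: step_pmf_def map_pmf_def bind_assoc_pmf bind_return_pmf)

lemma length_history_pmf: "h \<in> set_pmf (history_pmf r S n t) \<Longrightarrow> length h = t"
  by (induction t arbitrary: h) auto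

lemma finite_r_sets: "finite (r_sets r n)"
  unfolding r_sets_def by (rule finite_subset[of _ "Pow {1..n}"]) auto

lemma card_r_sets: "card (r_sets r n) = n choose r"
  unfolding r_sets_def using n_subsets[of "{1..n}" r] by simp

section \<open>Probability of creating a prescribed edge in one step\<close>

text \<open>At most \<open>2 ^ s\<close> of the equally likely \<open>r\<close>-sets lie inside
  \<open>X\<close>, and there are at least \<open>(n / r) ^ r\<close> of them in total.\<close>

lemma prob_r_set_subset_le:
  assumes "1 \<le> r" "r \<le> n" "finite X" "card X \<le> s"
  shows "measure_pmf.prob (pmf_of_set (r_sets r n)) {U. U \<subseteq> X} \<le> 2 ^ s * real r ^ r / real n ^ r"
proof -
  have ne: "r_sets r n \<noteq> {}"
    using card_r_sets[of r n] assms by force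
  have "card (r_sets r n \<inter> {U. U \<subseteq> X}) \<le> card (Pow X)"
    using assms by (intro card_mono) auto
  also have "\<dots> \<le> 2 ^ s"
    using assms by (simp add: card_Pow)
  finally have num: "real (card (r_sets r n \<inter> {U. U \<subseteq> X})) \<le> 2 ^ s"
    by (metis of_nat_le_iff of_nat_numeral of_nat_power)
  have den: "(real n / real r) ^ r \<le> real (n choose r)"
    using binomial_ge_n_over_k_pow_k[of r n, where 'a = real] assms by simp
  have "measure_pmf.prob (pmf_of_set (r_sets r n)) {U. U \<subseteq> X}
      = real (card (r_sets r n \<inter> {U. U \<subseteq> X})) / real (n choose r)"
    using ne by (simp add: measure_pmf_of_set finite_r_sets card_r_sets)
  also have "\<dots> \<le> 2 ^ s / (real n / real r) ^ r"
    using num den assms by (intro frac_le) auto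
  also have "\<dots> = 2 ^ s * real r ^ r / real n ^ r"
    by (simp add: power_divide)
  finally show ?thesis .
qed

text \<open>Whatever \<open>V\<close> the player adds, producing \<open>e\<close> forces
  \<open>U \<subseteq> set_mset e\<close>. Bounding the player's conditional probability by 1 makes
  the estimate independent of \<open>S\<close> and \<open>h\<close>.\<close>

lemma emeasure_step_edge_le:
  assumes "1 \<le> r" "r \<le> n" "size e = s"
  shows "emeasure (step_pmf r S n h) {(U, V). mset_set U + V = e}
           \<le> ennreal (2 ^ s * real r ^ r / real n ^ r)"
proof -
  have ne: "r_sets r n \<noteq> {}"
    using card_r_sets[of r n] assms by force
  \<comment> \<open>\<open>mset_set\<close> of an infinite set is empty, so reading
    \<open>U \<subseteq> set_mset e\<close> off the edge equation relies on finiteness.\<close>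
  have fin: "finite U" if "U \<in> set_pmf (pmf_of_set (r_sets r n))" for U
    using that ne by (auto simp: finite_r_sets r_sets_def intro: finite_subset)
  have "card (set_mset e) \<le> s"
    using assms(3) card_set_mset_le_size by blast
  then have X: "measure_pmf.prob (pmf_of_set (r_sets r n)) {U. U \<subseteq> set_mset e}
      \<le> 2 ^ s * real r ^ r / real n ^ r"
    using assms by (intro prob_r_set_subset_le) auto
  have "emeasure (step_pmf r S n h) {(U, V). mset_set U + V = e}
      = (\<integral>\<^sup>+ U. emeasure (S n h U) {V. mset_set U + V = e} \<partial>pmf_of_set (r_sets r n))"
    by (simp add: step_pmf_def emeasure_bind_pmf vimage_def)
  also have "\<dots> \<le> (\<integral>\<^sup>+ U. indicator {U. U \<subseteq> set_mset e} U \<partial>pmf_of_set (r_sets r n))"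
  proof (intro nn_integral_mono_AE, unfold AE_measure_pmf_iff, intro ballI)
    fix U assume U: "U \<in> set_pmf (pmf_of_set (r_sets r n))"
    show "emeasure (S n h U) {V. mset_set U + V = e} \<le> indicator {U. U \<subseteq> set_mset e} U"
    proof (cases "U \<subseteq> set_mset e")
      case True
      then show ?thesis
        by (simp add: measure_pmf.emeasure_le_1)
    next
      case False
      then have "{V. mset_set U + V = e} = {}"
        using fin[OF U] by auto
      then show ?thesis
        by (simp only: emeasure_empty) simp
    qed
  qed
  also have "\<dots> = emeasure (pmf_of_set (r_sets r n)) {U. U \<subseteq> set_mset e}"
    by simp
  also have "\<dots> \<le> ennreal (2 ^ s * real r ^ r / real n ^ r)"
    using X by (simp add: measure_pmf.emeasure_eq_measure ennreal_leI)
  finally show ?thesis .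
qed

section \<open>Maps that place a set of edges, and their one-step recursion\<close>

text \<open>The images are compared as multisets: edges of \<open>A\<close> with a common image must
  be matched by as many parallel edges. Injectivity of \<open>f\<close> is not imposed; admitting
  more maps only enlarges the first moment.\<close>

definition placed :: "('a \<Rightarrow> nat) \<Rightarrow> 'a multiset set \<Rightarrow> history set" where
  "placed f A = {h. image_mset (image_mset f) (mset_set A) \<subseteq># hist_edges h}"

text \<open>If the last edge was indispensable, it is the image of some \<open>e\<close> in
  \<open>A\<close>; cancelling one occurrence of it on both sides leaves the image of
  \<open>A - {e}\<close> inside the earlier edges.\<close>

lemma placed_snoc:
  assumes "finite A" "h @ [(U, V)] \<in> placed f A"
  shows "h \<in> placed f A \<or>
    (\<exists>e\<in>A. h \<in> placed f (A - {e}) \<and> mset_set U + V = image_mset f e)"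
proof (cases "h \<in> placed f A")
  case False
  define c where "c = mset_set U + V"
  define B where "B = image_mset (image_mset f) (mset_set A)"
  have sub: "B \<subseteq># add_mset c (hist_edges h)" and nsub: "\<not> B \<subseteq># hist_edges h"
    using assms(2) False by (auto simp: placed_def hist_edges_def B_def c_def)
  have "c \<in># B"
    using sub nsub by (metis diff_single_trivial insert_DiffM2 subset_eq_diff_conv
        add_mset_remove_trivial_If add_mset_add_single)
  then obtain e where e: "e \<in> A" "c = image_mset f e"
    using assms(1) by (auto simp: B_def)
  have "B = add_mset c (image_mset (image_mset f) (mset_set (A - {e})))"
    using e assms(1) by (simp add: B_def mset_set.remove)
  with sub have "image_mset (image_mset f) (mset_set (A - {e})) \<subseteq># hist_edges h"
    by simp
  with e show ?thesis
    by (auto simp: placed_def c_def)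
qed auto

lemma emeasure_placed_Suc:
  assumes "1 \<le> r" "r \<le> n" "finite A" "\<And>e. e \<in> A \<Longrightarrow> size e = s"
  shows "emeasure (history_pmf r S n (Suc t)) (placed f A)
    \<le> emeasure (history_pmf r S n t) (placed f A) +
       ennreal (2 ^ s * real r ^ r / real n ^ r) *
       (\<Sum>e\<in>A. emeasure (history_pmf r S n t) (placed f (A - {e})))"
    (is "_ \<le> _ + ?p * _")
proof -
  have step: "emeasure (step_pmf r S n h) {x. h @ [x] \<in> placed f A}
      \<le> indicator (placed f A) h + ?p * (\<Sum>e\<in>A. indicator (placed f (A - {e})) h)" for h
  proof (cases "h \<in> placed f A")
    case True
    then have "(1::ennreal) \<le> indicator (placed f A) h + ?p * (\<Sum>e\<in>A. indicator (placed f (A - {e})) h)"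
      by simp
    then show ?thesis
      using measure_pmf.emeasure_le_1 order_trans by blast
  next
    case False
    \<comment> \<open>Only an edge whose companions are all placed already can be the one completed
      now; the union bound pays \<open>?p\<close> for each of these.\<close>
    define A' where "A' = {e\<in>A. h \<in> placed f (A - {e})}"
    have fin: "finite A'"
      using assms by (simp add: A'_def)
    have "{x. h @ [x] \<in> placed f A} \<subseteq> (\<Union>e\<in>A'. {(U, V). mset_set U + V = image_mset f e})"
      using placed_snoc[OF assms(3)] False by (fastforce simp: A'_def)
    then have "emeasure (step_pmf r S n h) {x. h @ [x] \<in> placed f A}
        \<le> emeasure (step_pmf r S n h) (\<Union>e\<in>A'. {(U, V). mset_set U + V = image_mset f e})"
      by (intro emeasure_mono) auto
    also have "\<dots> \<le> (\<Sum>e\<in>A'. emeasure (step_pmf r S n h) {(U, V). mset_set U + V = image_mset f e})"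
      using fin by (intro emeasure_subadditive_finite) auto
    also have "\<dots> \<le> (\<Sum>e\<in>A'. ?p)"
      using assms by (intro sum_mono emeasure_step_edge_le) (auto simp: A'_def)
    also have "\<dots> = ?p * (\<Sum>e\<in>A'. 1)"
      by (simp add: mult.commute)
    also have "(\<Sum>e\<in>A'. 1) = (\<Sum>e\<in>A. indicator (placed f (A - {e})) h :: ennreal)"
      using assms(3) unfolding A'_def by (simp add: indicator_def sum.If_cases Int_def)
    finally show ?thesis
      using False by simp
  qed
  have "emeasure (history_pmf r S n (Suc t)) (placed f A)
      = (\<integral>\<^sup>+ h. emeasure (step_pmf r S n h) {x. h @ [x] \<in> placed f A} \<partial>history_pmf r S n t)"
    unfolding history_pmf_Suc by (simp add: emeasure_bind_pmf vimage_def)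
  also have "\<dots> \<le> (\<integral>\<^sup>+ h. indicator (placed f A) h
      + ?p * (\<Sum>e\<in>A. indicator (placed f (A - {e})) h) \<partial>history_pmf r S n t)"
    by (intro nn_integral_mono step)
  also have "\<dots> = emeasure (history_pmf r S n t) (placed f A) +
       ?p * (\<Sum>e\<in>A. emeasure (history_pmf r S n t) (placed f (A - {e})))"
    by (simp add: nn_integral_add nn_integral_cmult nn_integral_sum)
  finally show ?thesis .
qed

section \<open>Deterministic count of maps hitting a single edge\<close>

text \<open>The \<open>s\<close> distinct vertices of \<open>e\<close> must go into the at most
  \<open>s\<close> vertices of \<open>c\<close>, while the remaining vertices are free. If
  \<open>c\<close> does not have size \<open>s\<close>, there is no such map.\<close>

lemma card_maps_image_mset_eq:
  assumes "finite V" "set_mset e \<subseteq> V" "\<And>v. count e v \<le> 1" "size e = s"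
  shows "card {f \<in> V \<rightarrow>\<^sub>E {1..n}. image_mset f e = c} \<le> s ^ s * n ^ (card V - s)"
proof (cases "size c = s")
  case True
  have ce: "card (set_mset e) = s"
    using mset_set_set_mset_distinct[OF assms(3)] assms(4) by (metis size_mset_set)
  have cc: "card (set_mset c) \<le> s"
    using True card_set_mset_le_size by blast
  let ?X = "\<lambda>v. if v \<in> set_mset e then set_mset c else {1..n}"
  have "{f \<in> V \<rightarrow>\<^sub>E {1..n}. image_mset f e = c} \<subseteq> (\<Pi>\<^sub>E v\<in>V. ?X v)"
    by (auto simp: PiE_iff extensional_def)
  then have "card {f \<in> V \<rightarrow>\<^sub>E {1..n}. image_mset f e = c} \<le> card (\<Pi>\<^sub>E v\<in>V. ?X v)"
    using assms(1) by (intro card_mono finite_PiE) auto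
  also have "\<dots> = (\<Prod>v\<in>V. card (?X v))"
    using assms(1) by (rule card_PiE)
  also have "\<dots> = (\<Prod>v\<in>V. if v \<in> set_mset e then card (set_mset c) else n)"
    by (intro prod.cong) auto
  also have "\<dots> = card (set_mset c) ^ card (set_mset e) * n ^ card (V - set_mset e)"
    using assms(1,2) by (subst prod.If_cases) (auto simp: Int_absorb1 Diff_eq)
  also have "card (V - set_mset e) = card V - s"
    using assms(2) ce by (simp add: card_Diff_subset)
  also have "card (set_mset c) ^ card (set_mset e) * n ^ (card V - s) \<le> s ^ s * n ^ (card V - s)"
    using cc ce by (simp add: power_mono)
  finally show ?thesis .
next
  case False
  then have "{f \<in> V \<rightarrow>\<^sub>E {1..n}. image_mset f e = c} = {}"
    using assms(4) by auto
  then show ?thesis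
    by (metis card.empty le0)
qed

lemma card_maps_placed_edge:
  assumes "finite V" "set_mset e \<subseteq> V" "\<And>v. count e v \<le> 1" "size e = s"
  shows "card {f \<in> V \<rightarrow>\<^sub>E {1..n}. h \<in> placed f {e}} \<le> length h * (s ^ s * n ^ (card V - s))"
proof -
  have "{f \<in> V \<rightarrow>\<^sub>E {1..n}. h \<in> placed f {e}}
      = (\<Union>c\<in>set_mset (hist_edges h). {f \<in> V \<rightarrow>\<^sub>E {1..n}. image_mset f e = c})"
    by (auto simp: placed_def)
  also have "card \<dots> \<le> (\<Sum>c\<in>set_mset (hist_edges h). card {f \<in> V \<rightarrow>\<^sub>E {1..n}. image_mset f e = c})"
    by (intro card_UN_le) auto
  also have "\<dots> \<le> (\<Sum>c\<in>set_mset (hist_edges h). s ^ s * n ^ (card V - s))"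
    using assms by (intro sum_mono card_maps_image_mset_eq)
  also have "\<dots> \<le> length h * (s ^ s * n ^ (card V - s))"
    using card_set_mset_le_size[of "hist_edges h"] by (simp add: hist_edges_def)
  finally show ?thesis .
qed

text \<open>The count holds for every history of length \<open>t\<close>, hence in expectation.
  Bounding the probability for each map separately by a constant times \<open>t / n ^ r\<close>
  would only give order \<open>t * n ^ (card V - r)\<close>; counting over the actual history
  replaces this \<open>r\<close> by \<open>s\<close>.\<close>

lemma expected_maps_placed_edge:
  assumes "finite V" "set_mset e \<subseteq> V" "\<And>v. count e v \<le> 1" "size e = s"
  shows "(\<Sum>f\<in>V \<rightarrow>\<^sub>E {1..n}. emeasure (history_pmf r S n t) (placed f {e}))
    \<le> ennreal (real t * (real s ^ s * real n ^ (card V - s)))"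
proof -
  have fin: "finite (V \<rightarrow>\<^sub>E {1..n})"
    using assms(1) by (simp add: finite_PiE)
  have "(\<Sum>f\<in>V \<rightarrow>\<^sub>E {1..n}. emeasure (history_pmf r S n t) (placed f {e}))
      = (\<integral>\<^sup>+ h. (\<Sum>f\<in>V \<rightarrow>\<^sub>E {1..n}. indicator (placed f {e}) h) \<partial>history_pmf r S n t)"
    by (simp add: nn_integral_sum)
  also have "\<dots> \<le> (\<integral>\<^sup>+ h. ennreal (real t * (real s ^ s * real n ^ (card V - s))) \<partial>history_pmf r S n t)"
  proof (intro nn_integral_mono_AE, unfold AE_measure_pmf_iff, intro ballI)
    fix h assume "h \<in> set_pmf (history_pmf r S n t)"
    then have len: "length h = t"
      by (rule length_history_pmf)
    have "(\<Sum>f\<in>V \<rightarrow>\<^sub>E {1..n}. indicator (placed f {e}) h)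
        = ennreal (real (card {f \<in> V \<rightarrow>\<^sub>E {1..n}. h \<in> placed f {e}}))"
      using fin by (simp add: indicator_def sum.If_cases Int_def ennreal_of_nat_eq_real_of_nat)
    also have "\<dots> \<le> ennreal (real t * (real s ^ s * real n ^ (card V - s)))"
    proof (rule ennreal_leI)
      have "real (card {f \<in> V \<rightarrow>\<^sub>E {1..n}. h \<in> placed f {e}})
          \<le> real (length h * (s ^ s * n ^ (card V - s)))"
        using card_maps_placed_edge[OF assms] of_nat_le_iff by blast
      then show "real (card {f \<in> V \<rightarrow>\<^sub>E {1..n}. h \<in> placed f {e}})
          \<le> real t * (real s ^ s * real n ^ (card V - s))"
        using len by simp
    qed
    finally show "(\<Sum>f\<in>V \<rightarrow>\<^sub>E {1..n}. indicator (placed f {e}) h)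
        \<le> ennreal (real t * (real s ^ s * real n ^ (card V - s)))" .
  qed
  also have "\<dots> = ennreal (real t * (real s ^ s * real n ^ (card V - s)))"
    by simp
  finally show ?thesis .
qed

section \<open>Solving the recursion for the expected number of maps\<close>

text \<open>The left side consists of the two leading terms of the binomial expansion; this closes
  the induction over time.\<close>

lemma power_Suc_add_le:
  fixes x :: real
  assumes "0 \<le> x"
  shows "x ^ Suc j + real (Suc j) * x ^ j \<le> (x + 1) ^ Suc j"
proof (induction j)
  case (Suc j)
  have "x ^ Suc (Suc j) + real (Suc (Suc j)) * x ^ Suc j
      \<le> (x ^ Suc j + real (Suc j) * x ^ j) * (x + 1)"
    using assms by (simp add: algebra_simps)
  also have "\<dots> \<le> (x + 1) ^ Suc j * (x + 1)"
    using Suc assms by (intro mult_right_mono) auto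
  finally show ?case
    by (simp add: mult.commute)
qed simp

text \<open>Outer induction on the number of edges, inner induction on \<open>t\<close>. The
  single-edge count starts it, and each further edge costs a factor \<open>t\<close> for its time of
  creation and one factor for the probability of creating it.\<close>

lemma expected_maps_placed:
  assumes "1 \<le> r" "r \<le> n" "finite V" "finite A" "card A = Suc j"
    and "\<And>e. e \<in> A \<Longrightarrow> set_mset e \<subseteq> V" "\<And>e v. e \<in> A \<Longrightarrow> count e v \<le> 1"
    and "\<And>e. e \<in> A \<Longrightarrow> size e = s"
  shows "(\<Sum>f\<in>V \<rightarrow>\<^sub>E {1..n}. emeasure (history_pmf r S n t) (placed f A))
    \<le> ennreal (real t ^ Suc j * (2 ^ s * real r ^ r / real n ^ r) ^ j
         * (real s ^ s * real n ^ (card V - s)))"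
  using assms(4-)
proof (induction j arbitrary: A t)
  case 0
  then obtain e where "A = {e}"
    by (auto simp: card_Suc_eq)
  with 0 expected_maps_placed_edge[OF assms(3), of e s r S n t] show ?case
    by (simp add: mult.assoc)
next
  case (Suc j)
  let ?p = "2 ^ s * real r ^ r / real n ^ r"
  let ?B = "real s ^ s * real n ^ (card V - s)"
  \<comment> \<open>The hypothesis for one edge fewer, valid at all times, is named here because the
    inner induction reuses the name \<open>Suc.IH\<close>.\<close>
  note A = Suc.prems and edge_IH = Suc.IH
  show ?case
  proof (induction t)
    case 0
    have "A \<noteq> {}"
      using A by auto
    then have "emeasure (history_pmf r S n 0) (placed f A) = 0" for f
      using A by (simp add: placed_def hist_edges_def mset_set_empty_iff)
    then show ?case
      by simp
  next
    case (Suc t)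
    have IH: "(\<Sum>f\<in>V \<rightarrow>\<^sub>E {1..n}. emeasure (history_pmf r S n t) (placed f (A - {e})))
        \<le> ennreal (real t ^ Suc j * ?p ^ j * ?B)" if "e \<in> A" for e
      using that A by (intro edge_IH) auto
    have "(\<Sum>f\<in>V \<rightarrow>\<^sub>E {1..n}. emeasure (history_pmf r S n (Suc t)) (placed f A))
        \<le> (\<Sum>f\<in>V \<rightarrow>\<^sub>E {1..n}. emeasure (history_pmf r S n t) (placed f A) +
             ennreal ?p * (\<Sum>e\<in>A. emeasure (history_pmf r S n t) (placed f (A - {e}))))"
      using assms(1,2) A by (intro sum_mono emeasure_placed_Suc) auto
    also have "\<dots> = (\<Sum>f\<in>V \<rightarrow>\<^sub>E {1..n}. emeasure (history_pmf r S n t) (placed f A)) +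
        ennreal ?p * (\<Sum>e\<in>A. \<Sum>f\<in>V \<rightarrow>\<^sub>E {1..n}. emeasure (history_pmf r S n t) (placed f (A - {e})))"
      by (subst sum.swap) (simp add: sum.distrib sum_distrib_left)
    also have "\<dots> \<le> ennreal (real t ^ Suc (Suc j) * ?p ^ Suc j * ?B) +
        ennreal ?p * (\<Sum>e\<in>A. ennreal (real t ^ Suc j * ?p ^ j * ?B))"
      by (intro add_mono mult_left_mono sum_mono IH Suc.IH) auto
    also have "\<dots> = ennreal (real t ^ Suc (Suc j) * ?p ^ Suc j * ?B +
        ?p * (\<Sum>e\<in>A. real t ^ Suc j * ?p ^ j * ?B))"
      by (subst sum_ennreal, simp, subst ennreal_mult[symmetric], simp, simp add: sum_nonneg,
          subst ennreal_plus[symmetric]) (auto intro!: mult_nonneg_nonneg sum_nonneg)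
    \<comment> \<open>The inner sum has \<open>card A = Suc (Suc j)\<close> equal terms, exactly the
      coefficient that \<open>power_Suc_add_le\<close> absorbs.\<close>
    also have "real t ^ Suc (Suc j) * ?p ^ Suc j * ?B + ?p * (\<Sum>e\<in>A. real t ^ Suc j * ?p ^ j * ?B)
        = (real t ^ Suc (Suc j) + real (Suc (Suc j)) * real t ^ Suc j) * (?p ^ Suc j * ?B)"
      unfolding sum_constant A(2) power_Suc[of ?p] by (simp only: distrib_left distrib_right ac_simps)
    also have "ennreal \<dots> \<le> ennreal (real (Suc t) ^ Suc (Suc j) * (?p ^ Suc j * ?B))"
      using power_Suc_add_le[of "real t" "Suc j"]
      by (intro ennreal_leI mult_right_mono) (auto simp: add.commute)
    finally show ?case
      by (simp only: mult.assoc)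
  qed
qed

section \<open>From copies of \<open>G\<close> to a probability bound\<close>

lemma contains_copy_imp_placed:
  assumes "uniform_hypergraph s G" "contains_copy G (history_hypergraph n h)"
  shows "\<exists>f\<in>verts G \<rightarrow>\<^sub>E {1..n}. h \<in> placed f (set_mset (edges G))"
proof -
  obtain H f where H: "sub_hypergraph H (history_hypergraph n h)"
    and f: "bij_betw f (verts G) (verts H)" "edges H = image_mset (image_mset f) (edges G)"
    using assms(2) unfolding contains_copy_def hypergraph_iso_def by blast
  \<comment> \<open>Restriction makes the map extensional, so it belongs to the finite set of maps
    over which the union bound runs.\<close>
  let ?g = "restrict f (verts G)"
  have G: "mset_set (set_mset (edges G)) = edges G"
    using assms(1) by (intro mset_set_set_mset_distinct) (simp add: uniform_hypergraph_def)
  have sub: "set_mset e \<subseteq> verts G" if "e \<in># edges G" for e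
    using that assms(1) by (simp add: uniform_hypergraph_def wf_hypergraph_def)
  have "image_mset (image_mset ?g) (edges G) = edges H"
    unfolding f(2) using sub by (intro image_mset_cong) auto
  then have "h \<in> placed ?g (set_mset (edges G))"
    using H by (simp add: placed_def G sub_hypergraph_def history_hypergraph_def hist_edges_def)
  moreover have "?g \<in> verts G \<rightarrow>\<^sub>E {1..n}"
    using f(1) H by (auto simp: bij_betw_def sub_hypergraph_def history_hypergraph_def)
  ultimately show ?thesis
    by blast
qed

lemma prob_contains_copy_le:
  fixes G :: "'a hypergraph"
  assumes "k \<ge> s" "r \<ge> 1" "n \<ge> r" "uniform_hypergraph s G"
    and "card (verts G) = k" "size (edges G) = m" "m \<ge> 1"
  shows "prob_property r S n t (contains_copy G)
    \<le> real s ^ s * (2 ^ s * real r ^ r) ^ (m - 1)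
       * (real t / real n powr (real r - (real k - real s + real r) / real m)) ^ m"
proof -
  let ?p = "2 ^ s * real r ^ r / real n ^ r"
  let ?B = "real s ^ s * real n ^ (k - s)"
  let ?E = "set_mset (edges G)"
  let ?a = "real r - (real k - real s + real r) / real m"
  have fin: "finite (verts G)"
    using assms(4) by (simp add: uniform_hypergraph_def wf_hypergraph_def)
  have "mset_set ?E = edges G"
    using assms(4) by (intro mset_set_set_mset_distinct) (simp add: uniform_hypergraph_def)
  then have card: "card ?E = Suc (m - 1)"
    using assms(6,7) by (metis size_mset_set Suc_diff_1 One_nat_def Suc_le_lessD)
  have "emeasure (history_pmf r S n t) {h. contains_copy G (history_hypergraph n h)}
      \<le> emeasure (history_pmf r S n t) (\<Union>f\<in>verts G \<rightarrow>\<^sub>E {1..n}. placed f ?E)"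
    using contains_copy_imp_placed[OF assms(4)] by (intro emeasure_mono) auto
  also have "\<dots> \<le> (\<Sum>f\<in>verts G \<rightarrow>\<^sub>E {1..n}. emeasure (history_pmf r S n t) (placed f ?E))"
    using fin by (intro emeasure_subadditive_finite finite_PiE) auto
  also have "\<dots> \<le> ennreal (real t ^ Suc (m - 1) * ?p ^ (m - 1)
      * (real s ^ s * real n ^ (card (verts G) - s)))"
    using assms(4) card fin assms(2,3)
    by (intro expected_maps_placed) (auto simp: uniform_hypergraph_def wf_hypergraph_def)
  finally have "prob_property r S n t (contains_copy G) \<le> real t ^ m * ?p ^ (m - 1) * ?B"
    using assms(5,7)
    by (simp add: prob_property_def semirandom_hypergraph_def vimage_def
        measure_pmf.emeasure_eq_measure)
  also have "\<dots> = real s ^ s * (2 ^ s * real r ^ r) ^ (m - 1) * real t ^ m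
      * (real n ^ (k - s) / real n ^ (r * (m - 1)))"
    by (simp add: power_divide power_mult)
  also have "real n ^ (k - s) / real n ^ (r * (m - 1)) = real n powr (real (k - s) - real (r * (m - 1)))"
    using assms(2,3) by (simp add: powr_diff powr_realpow del: of_nat_mult)
  \<comment> \<open>The exponent is \<open>k - s - r * (m - 1) = (k - s + r) - r * m\<close>, which
    is how \<open>?a\<close> arises.\<close>
  also have "real (k - s) - real (r * (m - 1)) = - (?a * real m)"
    using assms(1,7) by (simp add: of_nat_diff field_simps)
  also have "real n powr - (?a * real m) = 1 / (real n powr ?a) ^ m"
    using assms(2,3) by (simp add: powr_minus_divide powr_powr[symmetric] powr_realpow)
  finally show ?thesis
    by (simp add: power_divide)
qed

section \<open>Vanishing probability and the lower bound for \<open>tau\<close>\<close>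

theorem theorem1p7:
  fixes k s r m :: nat and G :: "'a hypergraph"
  assumes "k \<ge> s" and "s \<ge> r" and "r \<ge> 2"
    and "uniform_hypergraph s G"
    and "card (verts G) = k" and "size (edges G) = m" and "m \<ge> 1"
  shows "(\<forall>(\<omega> :: nat \<Rightarrow> real) (S :: strategy).
            filterlim \<omega> at_top sequentially \<longrightarrow> valid_strategy r s S \<longrightarrow>
            (\<lambda>n. prob_property r S n
                   (nat \<lfloor>real n powr (real r - (real k - real s + real r) / real m) / \<omega> n\<rfloor>)
                   (contains_copy G)) \<longlonglongrightarrow> 0)
       \<and> tau r s (contains_copy G)
           \<ge> ereal (real r - (real k - real s + real r) / real m)"
proof (intro conjI allI impI)
  let ?a = "real r - (real k - real s + real r) / real m"
  define C where "C = real s ^ s * (2 ^ s * real r ^ r) ^ (m - 1)"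
  have C: "C > 0"
    using assms(2,3) by (auto simp: C_def)
  have bound: "prob_property r S n t (contains_copy G) \<le> C * (real t / real n powr ?a) ^ m"
    if "n \<ge> r" for S n t
    unfolding C_def using assms that by (intro prob_contains_copy_le) auto
  {
    fix \<omega> :: "nat \<Rightarrow> real" and S :: strategy
    assume \<omega>: "filterlim \<omega> at_top sequentially"
    let ?t = "\<lambda>n. nat \<lfloor>real n powr ?a / \<omega> n\<rfloor>"
    have "(\<lambda>n. C * inverse (\<omega> n) ^ m) \<longlonglongrightarrow> C * 0 ^ m"
      by (intro tendsto_intros tendsto_inverse_0_at_top \<omega>)
    also have "C * 0 ^ m = 0"
      using assms(7) by simp
    finally have lim: "(\<lambda>n. C * inverse (\<omega> n) ^ m) \<longlonglongrightarrow> 0" .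
    \<comment> \<open>Positivity keeps the argument of the floor nonnegative, so that
      \<open>nat\<close> does not truncate a negative value.\<close>
    have "\<forall>\<^sub>F n in sequentially. \<omega> n > 0"
      using \<omega> by (simp add: filterlim_at_top_dense)
    then have "\<forall>\<^sub>F n in sequentially.
        prob_property r S n (?t n) (contains_copy G) \<le> C * inverse (\<omega> n) ^ m"
      using eventually_ge_at_top[of r]
    proof eventually_elim
      case (elim n)
      have n: "real n powr ?a > 0"
        using elim assms(3) by simp
      have "real (?t n) \<le> real n powr ?a / \<omega> n"
        using elim by (intro of_nat_floor) simp
      then have "real (?t n) / real n powr ?a \<le> real n powr ?a / \<omega> n / real n powr ?a"
        by (intro divide_right_mono) auto
      also have "\<dots> = inverse (\<omega> n)"
        using n by (simp add: inverse_eq_divide)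
      finally have "real (?t n) / real n powr ?a \<le> inverse (\<omega> n)" .
      then have "(real (?t n) / real n powr ?a) ^ m \<le> inverse (\<omega> n) ^ m"
        by (intro power_mono) auto
      then show ?case
        using bound[OF elim(2), of S "?t n"] C
        by (meson mult_left_mono order_less_imp_le order_trans)
    qed
    then show "(\<lambda>n. prob_property r S n (?t n) (contains_copy G)) \<longlonglongrightarrow> 0"
      by (intro tendsto_sandwich[OF _ _ tendsto_const lim])
        (auto simp: prob_property_def)
  }
  have limsup: "ereal ?a \<le> tau_limsup r s (contains_copy G) q" if q: "0 < q" for q
  proof -
    \<comment> \<open>Chosen so that \<open>C * D ^ m = q\<close>: reaching probability
      \<open>q\<close> then takes at least \<open>D * n powr ?a\<close> steps.\<close>
    define D where "D = root m (q / C)"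
    have D: "D > 0" "D ^ m = q / C"
      using q C assms(7) by (auto simp: D_def real_root_gt_zero)
    have "\<forall>\<^sub>F n in sequentially. ereal (?a + ln D / ln (real n))
        \<le> ln_enat (tau_q r s (contains_copy G) q n) / ereal (ln (real n))"
      \<comment> \<open>The 2 makes \<open>ln n\<close> positive for the division, and
        \<open>r\<close> makes \<open>bound\<close> applicable.\<close>
      using eventually_ge_at_top[of "max 2 r"]
    proof eventually_elim
      case (elim n)
      then have n: "real n powr ?a > 0" "ln (real n) > 0" "n \<ge> r"
        by auto
      define N where "N = nat \<lceil>D * real n powr ?a\<rceil>"
      have N: "D * real n powr ?a \<le> real N"
        unfolding N_def by linarith
      \<comment> \<open>This keeps \<open>ln_enat (enat N)\<close> away from its value minus
        infinity at 0.\<close>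
      then have N0: "real N > 0"
        using D(1) n(1) by (meson less_le_trans mult_pos_pos)
      have "enat N \<le> enat t" if "q \<le> prob_property r S n t (contains_copy G)" for S t
      proof -
        have "q \<le> C * (real t / real n powr ?a) ^ m"
          using that bound[OF n(3), of S t] by linarith
        then have "D ^ m \<le> (real t / real n powr ?a) ^ m"
          using C by (simp add: D(2) field_simps)
        then have "D \<le> real t / real n powr ?a"
          using assms(7) by (intro power_le_imp_le_base[of D "m - 1"]) auto
        then have "D * real n powr ?a \<le> real t"
          using n(1) by (simp add: field_simps)
        then show ?thesis
          by (simp add: N_def ceiling_le_iff nat_le_iff)
      qed
      \<comment> \<open>\<open>N\<close> depends on neither \<open>S\<close> nor \<open>t\<close>,
        so it bounds both nested infima; an infinite stopping time is covered as well.\<close>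
      then have "enat N \<le> tau_q r s (contains_copy G) q n"
        unfolding tau_q_def tau_strategy_def by (intro INF_greatest) auto
      then have "ln_enat (enat N) \<le> ln_enat (tau_q r s (contains_copy G) q n)"
        by (rule ln_enat_mono)
      moreover have "ereal (?a * ln (real n) + ln D) \<le> ln_enat (enat N)"
      proof -
        have "?a * ln (real n) + ln D = ln (D * real n powr ?a)"
          using D(1) n by (subst ln_mult) (auto simp: ln_powr)
        also have "\<dots> \<le> ln (real N)"
          using N D(1) n(1) N0 by (subst ln_le_cancel_iff) auto
        finally show ?thesis
          using N0 by (simp add: ln_enat_def)
      qed
      ultimately have "ereal (?a * ln (real n) + ln D) / ereal (ln (real n))
          \<le> ln_enat (tau_q r s (contains_copy G) q n) / ereal (ln (real n))"
        using n(2) by (intro ereal_divide_right_mono) auto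
      then show ?case
        using n(2) by (simp add: add_divide_distrib)
    qed
    then have "limsup (\<lambda>n. ereal (?a + ln D / ln (real n))) \<le> tau_limsup r s (contains_copy G) q"
      unfolding tau_limsup_def by (rule Limsup_mono)
    \<comment> \<open>The constant \<open>D\<close>, and with it \<open>q\<close>, disappears on the
      logarithmic scale.\<close>
    moreover have "(\<lambda>n. ?a + ln D / ln (real n)) \<longlonglongrightarrow> ?a + 0"
      by (intro tendsto_intros tendsto_divide_0[OF tendsto_const]
          filterlim_compose[OF filterlim_at_top_imp_at_infinity[OF ln_at_top]]
          filterlim_real_sequentially)
    then have "limsup (\<lambda>n. ereal (?a + ln D / ln (real n))) = ereal ?a"
      by (intro lim_imp_Limsup) auto
    ultimately show ?thesis
      by simp
  qed
  show "ereal ?a \<le> tau r s (contains_copy G)"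
  proof (rule tendsto_lowerbound[OF tendsto_tau])
    show "\<forall>\<^sub>F q in at_left 1. ereal ?a \<le> tau_limsup r s (contains_copy G) q"
      \<comment> \<open>Only \<open>q\<close> in the interval from 0 to 1 matters near the left of
        1, and there \<open>limsup\<close> gives the same bound for all \<open>q\<close>.\<close>
      using eventually_at_left_real[of 0 1] by (auto elim!: eventually_mono intro: limsup)
  qed simp
qed

end
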